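(* For integers $n\geq 0$ let $P_n(x)=2^{-2n}\sum_{j=0}^{n} 2^j\binom{2n-2j}{n-j}\binom{n+j}{j}(x+1)^j$, write $P_n(x)=\sum_{i=0}^n d_i(n)x^i$, and define $Q_n(x)=\sum_{i=0}^n \frac{d_i(n)}{i!}x^i$. Then $\{Q_n(x)\}_{n\geq 0}$ is a Sturm sequence. In particular, $Q_n(x)$ has only real zeros for every $n\geq 1$.
   Context: A real polynomial is standard if it is zero or has positive leading coefficient. $\mathrm{RZ}$ denotes the set of real polynomials with only real zeros. If $f\in\mathrm{RZ}$ has degree $n$ with zeros $r_n\le\cdots\le r_1$ and $g\in\mathrm{RZ}$ has degree $m$ with zeros $s_m\le\cdots\le s_1$, then $g$ interlaces $f$ if $n=m+1$ and $r_n\le s_{n-1}\le r_{n-1}\le\cdots\le r_2\le s_1\le r_1$; $g$ strictly interlaces $f$ (written $g\prec f$) if in addition $f$ and $g$ have no common zeros. By convention, for any real numbers $a,b,c$, the constant $a$ is in $\mathrm{RZ}$ and $a\prec bx+c$. A sequence $\{f_n(x)\}_{n\ge 0}$ of standard polynomials is a Sturm sequence if for all $n\ge 0$: $\deg f_n=n$, $f_n\in\mathrm{RZ}$, and $f_n\prec f_{n+1}$. *)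

theory Defs
  imports "HOL-Computational_Algebra.Computational_Algebra" Complex_Main
begin

definition standard_poly :: "real poly \<Rightarrow> bool" where
  "standard_poly f \<longleftrightarrow> f = 0 \<or> lead_coeff f > 0"

text \<open>The zero polynomial is included: every real constant belongs to RZ by convention.\<close>

definition RZ :: "real poly set" where
  "RZ = {f. f = 0 \<or> (\<forall>z::complex. poly (map_poly complex_of_real f) z = 0 \<longrightarrow> z \<in> \<real>)}"

text \<open>The real zeros, with multiplicity and in decreasing order, so that the zero called
  \<open>r\<^sub>1\<close> (the largest) has index 0. For a nonzero \<open>f \<in> RZ\<close> this list has length \<open>degree f\<close>.\<close>

definition zeros :: "real poly \<Rightarrow> real list" where
  "zeros f = rev (sorted_list_of_multiset (proots f))"

definition interlaces :: "real poly \<Rightarrow> real poly \<Rightarrow> bool" where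
  "interlaces g f \<longleftrightarrow>
     f \<in> RZ \<and> g \<in> RZ \<and> f \<noteq> 0 \<and> g \<noteq> 0 \<and> degree f = degree g + 1 \<and>
     (\<forall>i<degree g. zeros f ! (i + 1) \<le> zeros g ! i \<and> zeros g ! i \<le> zeros f ! i)"

text \<open>The first disjunct is the convention \<open>a \<prec> b x + c\<close> for arbitrary real numbers
  \<open>a\<close>, \<open>b\<close>, \<open>c\<close>. Since all zeros are real, it suffices to exclude real common zeros.\<close>

definition strictly_interlaces :: "real poly \<Rightarrow> real poly \<Rightarrow> bool"  (infix "\<prec>" 50) where
  "g \<prec> f \<longleftrightarrow>
     (\<exists>a b c. g = [:a:] \<and> f = [:c, b:]) \<or>
     (interlaces g f \<and> \<not> (\<exists>x. poly f x = 0 \<and> poly g x = 0))"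

text \<open>The condition \<open>f n \<noteq> 0\<close> matters only for \<open>n = 0\<close>: in the library the zero polynomial
  has degree 0, whereas a polynomial of degree 0 is meant to be a nonzero constant.\<close>

definition Sturm_sequence :: "(nat \<Rightarrow> real poly) \<Rightarrow> bool" where
  "Sturm_sequence f \<longleftrightarrow>
     (\<forall>n. standard_poly (f n) \<and> f n \<noteq> 0 \<and> degree (f n) = n \<and> f n \<in> RZ \<and> f n \<prec> f (Suc n))"

text \<open>The Boros--Moll polynomials, their coefficients, and the associated polynomials with the
  \<open>i\<close>-th coefficient divided by \<open>i!\<close>.\<close>

definition BM_P :: "nat \<Rightarrow> real poly" where
  "BM_P n = smult (1 / 2 ^ (2 * n))
     (\<Sum>j=0..n. smult (2 ^ j * real ((2 * n - 2 * j) choose (n - j)) * real ((n + j) choose j))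
                  ([:1, 1:] ^ j))"

definition BM_coeff :: "nat \<Rightarrow> nat \<Rightarrow> real" where
  "BM_coeff i n = coeff (BM_P n) i"

definition BM_Q :: "nat \<Rightarrow> real poly" where
  "BM_Q n = (\<Sum>i=0..n. monom (BM_coeff i n / fact i) i)"

end

theory Submission
  imports Defs
begin

text \<open>
  For \<open>m \<ge> 1\<close> the polynomials satisfy the recurrence
  \<open>4(m+1)\<^sup>2 Q\<^bsub>m+1\<^esub> = (16m\<^sup>2+16m+6 + 4(2m+1)x) Q\<^bsub>m\<^esub> + 4x Q'\<^bsub>m\<^esub> - (16m\<^sup>2-1) Q\<^bsub>m-1\<^esub>\<close>.
  It comes from a recurrence for \<open>P\<^bsub>m\<^esub>\<close> that can be checked termwise in powers of \<open>x + 1\<close>, because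
  there the coefficients are hypergeometric. All coefficients of \<open>Q\<^bsub>m\<^esub>\<close> are positive, so its zeros
  are negative. At such a zero the values of \<open>Q'\<^bsub>m\<^esub>\<close> and (by induction) \<open>Q\<^bsub>m-1\<^esub>\<close> have the same sign,
  and \<open>Q\<^bsub>m+1\<^esub>\<close> has the opposite one. Thus \<open>Q\<^bsub>m+1\<^esub>\<close> alternates in sign along the zeros of \<open>Q\<^bsub>m\<^esub>\<close>,
  and the intermediate value theorem yields interlacing zeros.
\<close>

section \<open>Real polynomials with simple real zeros\<close>

text \<open>The zeros are indexed from 0 in strictly decreasing order to match the list
  \<open>zeros\<close>. As \<open>n\<close> is also the degree, these are all the zeros and each is
  simple.\<close>

definition simple_zeros :: "real poly \<Rightarrow> nat \<Rightarrow> (nat \<Rightarrow> real) \<Rightarrow> bool" where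
  "simple_zeros f n r \<longleftrightarrow> degree f = n \<and> lead_coeff f > 0 \<and>
     (\<forall>i j. i < j \<longrightarrow> j < n \<longrightarrow> r j < r i) \<and> (\<forall>i<n. poly f (r i) = 0)"

lemma simple_zeros_inj_on:
  assumes "simple_zeros f n r"
  shows "inj_on r {..<n}"
proof (rule inj_onI)
  fix i j assume "i \<in> {..<n}" "j \<in> {..<n}" "r i = r j"
  then show "i = j"
    using assms unfolding simple_zeros_def by (metis lessThan_iff less_irrefl nat_neq_iff)
qed

text \<open>Both sides have degree at most \<open>n\<close> and the same coefficient at
  \<open>n\<close>, so agreement at the \<open>n\<close> distinct points \<open>r i\<close> forces
  equality.\<close>

lemma simple_zeros_factor:
  assumes "simple_zeros f n r"
  shows "f = smult (lead_coeff f) (\<Prod>i<n. [:- r i, 1:])"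
proof -
  let ?p = "\<Prod>i<n. [:- r i, 1:]"
  have deg: "degree ?p = n"
    by (subst degree_prod_eq_sum_degree) auto
  have monic: "coeff ?p n = 1"
    using lead_coeff_prod[of "\<lambda>i. [:- r i, 1:]" "{..<n}"] deg by simp
  show ?thesis
  proof (rule poly_eqI_degree_lead_coeff[where n = n and A = "r ` {..<n}"])
    show "card (r ` {..<n}) \<ge> n"
      using simple_zeros_inj_on[OF assms] by (simp add: card_image)
    show "poly f z = poly (smult (lead_coeff f) ?p) z" if "z \<in> r ` {..<n}" for z
      using that assms by (auto simp: simple_zeros_def poly_prod)
  qed (use assms deg monic in \<open>auto simp: simple_zeros_def\<close>)
qed

lemma simple_zeros_poly:
  assumes "simple_zeros f n r"
  shows "poly f x = lead_coeff f * (\<Prod>i<n. x - r i)"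
  by (subst simple_zeros_factor[OF assms]) (simp add: poly_prod)

lemma simple_zeros_zeros:
  assumes "simple_zeros f n r"
  shows "zeros f = map r [0..<n]"
proof -
  have "proots f = proots (\<Prod>i<n. [:- r i, 1:])"
    using assms by (subst simple_zeros_factor[OF assms], subst proots_smult)
      (auto simp: simple_zeros_def)
  also have "\<dots> = (\<Sum>i<n. {#r i#})"
    by (subst proots_prod) auto
  also have "\<dots> = mset (rev (map r [0..<n]))"
    by (induction n) auto
  finally have "zeros f = rev (sort (rev (map r [0..<n])))"
    by (simp add: zeros_def del: mset_rev)
  moreover have "sorted (rev (map r [0..<n]))"
    unfolding sorted_wrt_rev
    using assms by (auto simp: sorted_wrt_iff_nth_less simple_zeros_def intro: less_imp_le)
  ultimately show ?thesis
    by (simp add: sorted_sort_id)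
qed

text \<open>The \<open>n\<close> listed reals are already as many complex roots as the degree
  allows; a nonreal root would be root number \<open>n + 1\<close>.\<close>

lemma simple_zeros_RZ:
  assumes "simple_zeros f n r"
  shows "f \<in> RZ"
proof -
  let ?p = "map_poly complex_of_real f"
  have eval: "poly ?p (of_real x) = of_real (poly f x)" for x
    by (induction f) (simp_all add: map_poly_pCons)
  have f0: "f \<noteq> 0"
    using assms by (auto simp: simple_zeros_def)
  then have p0: "?p \<noteq> 0"
    by (simp add: map_poly_eq_0_iff)
  have "z \<in> \<real>" if z: "poly ?p z = 0" for z
  proof (rule ccontr)
    assume nr: "z \<notin> \<real>"
    let ?A = "(\<lambda>i. complex_of_real (r i)) ` {..<n}"
    have inj: "inj_on (\<lambda>i. complex_of_real (r i)) {..<n}"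
      using simple_zeros_inj_on[OF assms] by (auto simp: inj_on_def)
    have "card (insert z ?A) = Suc n"
      using nr by (subst card_insert_disjoint) (auto simp: card_image[OF inj])
    moreover have "insert z ?A \<subseteq> {x. poly ?p x = 0}"
      using z assms by (auto simp: eval simple_zeros_def)
    ultimately have "Suc n \<le> card {x. poly ?p x = 0}"
      by (metis card_mono p0 poly_roots_finite)
    also have "\<dots> \<le> degree ?p"
      by (rule card_poly_roots_bound[OF p0])
    also have "\<dots> \<le> n"
      using assms by (simp add: degree_map_poly simple_zeros_def)
    finally show False by simp
  qed
  then show ?thesis
    by (simp add: RZ_def)
qed

section \<open>Signs at zeros and strict interlacing\<close>

text \<open>Meant for factors \<open>x - r i\<close> with the zeros in decreasing order: the sign is
  determined by the number \<open>k\<close> of zeros above \<open>x\<close>.\<close>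

lemma prod_sign:
  fixes h :: "nat \<Rightarrow> real"
  assumes "k \<le> n" and "\<And>i. i < k \<Longrightarrow> h i < 0" and "\<And>i. k \<le> i \<Longrightarrow> i < n \<Longrightarrow> h i > 0"
  shows "(-1) ^ k * (\<Prod>i<n. h i) > 0"
proof -
  have "(\<Prod>i<n. h i) = (\<Prod>i<k. h i) * (\<Prod>i=k..<n. h i)"
    using assms(1) by (metis prod.atLeastLessThan_concat lessThan_atLeast0 zero_le)
  moreover have "(-1) ^ k * (\<Prod>i<k. h i) = (\<Prod>i<k. - h i)"
    by (simp add: prod_uminus)
  moreover have "(\<Prod>i<k. - h i) > 0"
    by (rule prod_pos) (use assms in auto)
  moreover have "(\<Prod>i=k..<n. h i) > 0"
    by (rule prod_pos) (use assms in auto)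
  ultimately show ?thesis
    by (metis mult.assoc mult_pos_pos)
qed

text \<open>By the product rule only the product over the other zeros survives at
  \<open>r k\<close>, and exactly \<open>k\<close> of those zeros lie above
  \<open>r k\<close>.\<close>

lemma simple_zeros_pderiv_sign:
  assumes f: "simple_zeros f n r" and k: "k < n"
  shows "(-1) ^ k * poly (pderiv f) (r k) > 0"
proof -
  define g where "g = (\<Prod>i\<in>{..<n} - {k}. [:- r i, 1:])"
  have "(\<Prod>i<n. [:- r i, 1:]) = [:- r k, 1:] * g"
    using k unfolding g_def by (subst prod.remove[of _ k]) auto
  then have "f = smult (lead_coeff f) ([:- r k, 1:] * g)"
    using simple_zeros_factor[OF f] by simp
  then have "pderiv f = smult (lead_coeff f) (pderiv ([:- r k, 1:] * g))"
    by (metis pderiv_smult)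
  then have "poly (pderiv f) (r k) = lead_coeff f * poly g (r k)"
    by (simp add: pderiv_mult pderiv_pCons del: mult_pCons_left)
  \<comment> \<open>The omitted factor is replaced by 1, which is positive, so that
    \<open>prod_sign\<close> applies to the full index range.\<close>
  moreover have "poly g (r k) = (\<Prod>i<n. if i = k then 1 else r k - r i)"
    using k unfolding g_def
    by (subst prod.remove[of _ k]) (auto simp: poly_prod intro!: prod.cong)
  moreover have "(-1) ^ k * (\<Prod>i<n. if i = k then 1 else r k - r i) > 0"
    by (rule prod_sign) (use f k in \<open>auto simp: simple_zeros_def\<close>)
  moreover have "lead_coeff f > 0"
    using f unfolding simple_zeros_def by blast
  ultimately show ?thesis
    by (simp add: mult.left_commute)
qed

definition zeros_interlaced :: "nat \<Rightarrow> (nat \<Rightarrow> real) \<Rightarrow> (nat \<Rightarrow> real) \<Rightarrow> bool" where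
  "zeros_interlaced n r s \<longleftrightarrow> (\<forall>i<n. s (Suc i) < r i \<and> r i < s i)"

text \<open>Interlacing places exactly the \<open>k\<close> zeros \<open>r 0, ..., r (k - 1)\<close>
  of \<open>f\<close> above \<open>s k\<close>.\<close>

lemma simple_zeros_interlaced_sign:
  assumes r: "simple_zeros f n r" and s: "simple_zeros g (Suc n) s"
    and rs: "zeros_interlaced n r s" and k: "k \<le> n"
  shows "(-1) ^ k * poly f (s k) > 0"
proof -
  have dec: "s j \<le> s i" if "i \<le> j" "j \<le> n" for i j
    using s that unfolding simple_zeros_def by (metis le_neq_implies_less less_Suc_eq_le less_imp_le order_refl)
  have "(-1) ^ k * (\<Prod>i<n. s k - r i) > 0"
  proof (rule prod_sign[OF k])
    show "s k - r i < 0" if "i < k" for i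
    proof -
      have "s (Suc i) < r i" using rs that k by (simp add: zeros_interlaced_def)
      then show ?thesis using dec[of "Suc i" k] that k by simp
    qed
    show "s k - r i > 0" if "k \<le> i" "i < n" for i
    proof -
      have "r i < s i" using rs that by (simp add: zeros_interlaced_def)
      then show ?thesis using dec[of k i] that by simp
    qed
  qed
  moreover have "lead_coeff f > 0"
    using r unfolding simple_zeros_def by blast
  ultimately show ?thesis
    by (simp add: simple_zeros_poly[OF r] mult.left_commute)
qed

text \<open>A common zero would be some \<open>s k\<close>, but \<open>f\<close> has a definite sign
  there.\<close>

lemma strictly_interlaces_if_zeros_interlaced:
  assumes r: "simple_zeros f n r" and s: "simple_zeros g (Suc n) s"
    and rs: "zeros_interlaced n r s"
  shows "f \<prec> g"
proof -
  have "interlaces f g"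
    using assms simple_zeros_RZ[OF r] simple_zeros_RZ[OF s]
    by (auto simp: interlaces_def simple_zeros_zeros[OF r] simple_zeros_zeros[OF s]
        simple_zeros_def zeros_interlaced_def less_imp_le simp del: upt_Suc)
  moreover have "\<not> (poly g x = 0 \<and> poly f x = 0)" for x
  proof
    assume x: "poly g x = 0 \<and> poly f x = 0"
    have "lead_coeff g \<noteq> 0"
      using s by (auto simp: simple_zeros_def)
    then have "\<exists>k\<in>{..<Suc n}. x = s k"
      using x by (simp add: simple_zeros_poly[OF s] del: prod.lessThan_Suc)
    then obtain k where "k \<le> n" "x = s k"
      by (auto simp: less_Suc_eq_le)
    then show False
      using simple_zeros_interlaced_sign[OF r s rs] x by fastforce
  qed
  ultimately show ?thesis
    by (auto simp: strictly_interlaces_def)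
qed

section \<open>Interlacing from alternating signs\<close>

lemma poly_eventually_pos:
  fixes f :: "real poly"
  assumes "lead_coeff f > 0"
  shows "\<exists>M. \<forall>x\<ge>M. poly f x > 0"
  using poly_pinfty_gt_lc[OF assms] assms by (meson less_le_trans)

text \<open>Replacing \<open>x\<close> by \<open>-x\<close> multiplies the leading coefficient by
  \<open>(-1) ^ degree f\<close>, which reduces the claim to the behaviour at plus infinity.\<close>

lemma poly_eventually_sign_neg:
  fixes f :: "real poly"
  assumes "lead_coeff f > 0"
  shows "\<exists>M. \<forall>x\<le>M. (-1) ^ degree f * poly f x > 0"
proof -
  let ?g = "smult ((-1) ^ degree f) (pcompose f [:0, -1:])"
  have "lead_coeff ?g > 0"
    using assms lead_coeff_comp[of "[:0, -1::real:]" f]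
    by (simp add: power_mult_distrib[symmetric] mult.left_commute)
  then obtain M where M: "\<And>x. x \<ge> M \<Longrightarrow> poly ?g x > 0"
    using poly_eventually_pos by blast
  have "(-1) ^ degree f * poly f x > 0" if "x \<le> - M" for x
    using M[of "- x"] that by (simp add: poly_pcompose)
  then show ?thesis by blast
qed

text \<open>Together with the signs near both infinities, \<open>g\<close> alternates at
  \<open>n + 2\<close> points. The \<open>n + 1\<close> gaps each contain a zero, which exhausts the
  degree.\<close>

lemma zeros_interlaced_if_alternating:
  assumes r: "simple_zeros f n r" and deg: "degree g = Suc n" and lc: "lead_coeff g > 0"
    and alt: "\<And>i. i < n \<Longrightarrow> (-1) ^ i * poly g (r i) < 0"
  shows "\<exists>s. simple_zeros g (Suc n) s \<and> zeros_interlaced n r s"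
proof -
  obtain M where M: "\<And>x. x \<ge> M \<Longrightarrow> poly g x > 0"
    using poly_eventually_pos[OF lc] by blast
  obtain L where L: "\<And>x. x \<le> L \<Longrightarrow> (-1) ^ Suc n * poly g x > 0"
    using poly_eventually_sign_neg[OF lc] deg by metis
  \<comment> \<open>\<open>B\<close> dominates both thresholds and every zero of \<open>f\<close>,
    so \<open>B\<close> and \<open>-B\<close> can serve as the outermost sample points.\<close>
  define B where "B = \<bar>M\<bar> + \<bar>L\<bar> + (\<Sum>i<n. \<bar>r i\<bar>) + 1"
  \<comment> \<open>The sample points in decreasing order are
    \<open>B, r 0, ..., r (n - 1), -B\<close>; hence \<open>t (Suc i) = r i\<close> for
    \<open>i < n\<close>.\<close>
  define t where "t i = (if i = 0 then B else if i \<le> n then r (i - 1) else - B)" for i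
  have nn: "(\<Sum>i<n. \<bar>r i\<bar>) \<ge> 0"
    by (rule sum_nonneg) simp
  have rB: "\<bar>r i\<bar> < B" if "i < n" for i
    using member_le_sum[of i "{..<n}" "\<lambda>i. \<bar>r i\<bar>"] that by (simp add: B_def)
  have B: "B > 0" "B \<ge> M" "- B \<le> L" using nn unfolding B_def by linarith+
  have t_dec: "t (Suc i) < t i" if "i \<le> n" for i
  proof -
    have "r i < r (i - 1)" if "0 < i" "i < n"
      using r that by (simp add: simple_zeros_def)
    moreover have "\<bar>r (i - 1)\<bar> < B" if "0 < i"
      using rB[of "i - 1"] that \<open>i \<le> n\<close> by simp
    ultimately show ?thesis
      using that rB[of i] B(1) by (auto simp: t_def abs_less_iff)
  qed
  have t_sign: "(-1) ^ i * poly g (t i) > 0" if "i \<le> Suc n" for i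
  proof -
    consider "i = 0" | "0 < i" "i \<le> n" | "i = Suc n"
      using \<open>i \<le> Suc n\<close> by fastforce
    then show ?thesis
    proof cases
      case 1
      then show ?thesis using M[OF B(2)] by (simp add: t_def)
    next
      case 2
      then show ?thesis using alt[of "i - 1"] by (cases i) (auto simp: t_def)
    next
      case 3
      then show ?thesis using L[OF B(3)] by (simp add: t_def)
    qed
  qed
  have "\<exists>x. t (Suc i) < x \<and> x < t i \<and> poly g x = 0" if "i \<le> n" for i
  proof -
    have "poly g (t (Suc i)) * poly g (t i) < 0"
      using t_sign[of i] t_sign[of "Suc i"] that
      by (cases "even i") (simp_all add: mult_neg_pos mult_pos_neg)
    then show ?thesis
      using poly_IVT[OF t_dec[OF that]] by blast
  qed
  then obtain s where s: "\<And>i. i \<le> n \<Longrightarrow> t (Suc i) < s i \<and> s i < t i \<and> poly g (s i) = 0"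
    by metis
  have t_mono: "t j \<le> t i" if "i \<le> j" "j \<le> Suc n" for i j
    using that
  proof (induction j rule: dec_induct)
    case (step j)
    then show ?case using t_dec[of j] by simp
  qed simp
  have "s j < s i" if "i < j" "j < Suc n" for i j
    using s[of i] s[of j] t_mono[of "Suc i" j] that by force
  then have "simple_zeros g (Suc n) s"
    using deg lc s by (auto simp: simple_zeros_def)
  moreover have "s (Suc i) < r i \<and> r i < s i" if "i < n" for i
    using s[of i] s[of "Suc i"] that by (simp add: t_def)
  ultimately show ?thesis
    by (auto simp: zeros_interlaced_def)
qed

section \<open>Hypergeometric coefficients in powers of \<open>x + 1\<close>\<close>

text \<open>The coefficient of \<open>(x + 1)\<^sup>j\<close> in \<open>BM_P n\<close>. The case distinction is needed because for \<open>j > n\<close>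
  the truncated subtractions would make the first binomial coefficient \<open>1\<close>.\<close>

definition BM_c :: "nat \<Rightarrow> nat \<Rightarrow> real" where
  "BM_c n j = (if j \<le> n then 2 ^ j * real ((2 * n - 2 * j) choose (n - j))
     * real ((n + j) choose j) / 4 ^ n else 0)"

lemma BM_c_pos: "j \<le> n \<Longrightarrow> BM_c n j > 0"
  by (auto simp: BM_c_def intro!: divide_pos_pos mult_pos_pos)

text \<open>Two absorption identities, passing through \<open>Suc (2 * k) choose k\<close>.\<close>

lemma central_binomial_Suc:
  "(real k + 1) * real ((2 * Suc k) choose Suc k) = 2 * (2 * real k + 1) * real ((2 * k) choose k)"
proof -
  have "Suc k * ((2 * Suc k) choose Suc k) = 2 * (Suc k * (Suc (2 * k) choose k))"
    using Suc_times_binomial[of k "Suc (2 * k)"] by (simp del: binomial_Suc_Suc)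
  also have "Suc k * (Suc (2 * k) choose k) = Suc (2 * k) * ((2 * k) choose k)"
    using binomial_absorb_comp[of "Suc (2 * k)" k] by (simp del: binomial_Suc_Suc)
  finally have "Suc k * ((2 * Suc k) choose Suc k) = 2 * Suc (2 * k) * ((2 * k) choose k)"
    by (simp only: mult.assoc)
  then have "real (Suc k * ((2 * Suc k) choose Suc k)) = real (2 * Suc (2 * k) * ((2 * k) choose k))"
    by (rule arg_cong)
  then show ?thesis
    unfolding of_nat_mult by (simp add: add.commute)
qed

text \<open>Writing \<open>n = j + k\<close> removes the truncated subtractions.\<close>

lemma BM_c_add: "BM_c (j + k) j = 2 ^ j * real ((2 * k) choose k) * real ((2 * j + k) choose j) / 4 ^ (j + k)"
proof -
  have "j + k + j = 2 * j + k" "2 * (j + k) - 2 * j = 2 * k" by simp_all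
  then show ?thesis unfolding BM_c_def by (simp only: diff_add_inverse le_add1 if_True)
qed

text \<open>The term ratio in \<open>n\<close> for fixed \<open>j\<close>, with denominators
  cleared.\<close>

lemma BM_c_Suc_left:
  "2 * (real k + 1) * (real (j + k) + 1) * BM_c (Suc (j + k)) j
     = (2 * real k + 1) * (2 * real j + real k + 1) * BM_c (j + k) j"
proof -
  define A A' B B' where "A = real ((2 * k) choose k)" and "A' = real ((2 * Suc k) choose Suc k)"
    and "B = real ((2 * j + k) choose j)" and "B' = real ((2 * j + Suc k) choose j)"
  have A: "(real k + 1) * A' = 2 * (2 * real k + 1) * A"
    unfolding A_def A'_def by (rule central_binomial_Suc)
  have "Suc (j + k) * ((2 * j + Suc k) choose j) = (2 * j + Suc k) * ((2 * j + k) choose j)"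
    using binomial_absorb_comp[of "2 * j + Suc k" j] by simp
  then have "real (Suc (j + k) * ((2 * j + Suc k) choose j)) = real ((2 * j + Suc k) * ((2 * j + k) choose j))"
    by (rule arg_cong)
  then have B: "(real (j + k) + 1) * B' = (2 * real j + real k + 1) * B"
    unfolding of_nat_mult B_def B'_def by (simp add: add_ac)
  have "2 * (real k + 1) * (real (j + k) + 1) * BM_c (Suc (j + k)) j
      = ((real k + 1) * A') * ((real (j + k) + 1) * B') * 2 ^ j / (2 * 4 ^ (j + k))"
    using BM_c_add[of j "Suc k"] unfolding A'_def[symmetric] B'_def[symmetric] by (simp add: field_simps)
  also have "\<dots> = (2 * real k + 1) * (2 * real j + real k + 1) * BM_c (j + k) j"
    unfolding A B BM_c_add A_def[symmetric] B_def[symmetric] by (simp add: field_simps)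
  finally show ?thesis .
qed

text \<open>The term ratio in \<open>j\<close> for fixed \<open>n = j + k + 1\<close>, with
  denominators cleared.\<close>

lemma BM_c_Suc_right:
  "(2 * real k + 1) * (real j + 1) * BM_c (Suc (j + k)) (Suc j)
     = (real k + 1) * (2 * real j + real k + 2) * BM_c (Suc (j + k)) j"
proof -
  define A A' B B' where "A = real ((2 * k) choose k)" and "A' = real ((2 * Suc k) choose Suc k)"
    and "B = real ((2 * j + Suc k) choose j)" and "B' = real ((2 * Suc j + k) choose Suc j)"
  have A: "(real k + 1) * A' = 2 * (2 * real k + 1) * A"
    unfolding A_def A'_def by (rule central_binomial_Suc)
  have "Suc j * ((2 * Suc j + k) choose Suc j) = (2 * Suc j + k) * ((2 * j + Suc k) choose j)"
    using Suc_times_binomial[of j "2 * j + Suc k"] by simp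
  then have "real (Suc j * ((2 * Suc j + k) choose Suc j)) = real ((2 * Suc j + k) * ((2 * j + Suc k) choose j))"
    by (rule arg_cong)
  then have B: "(real j + 1) * B' = (2 * real j + real k + 2) * B"
    unfolding of_nat_mult B_def B'_def by (simp add: add_ac)
  have c: "BM_c (Suc (j + k)) (Suc j) = 2 * 2 ^ j * A * B' / 4 ^ Suc (j + k)"
    using BM_c_add[of "Suc j" k] unfolding A_def[symmetric] B'_def[symmetric] by simp
  have "(2 * real k + 1) * (real j + 1) * BM_c (Suc (j + k)) (Suc j)
      = (2 * (2 * real k + 1) * A) * ((real j + 1) * B') * 2 ^ j / 4 ^ Suc (j + k)"
    unfolding c by (simp add: field_simps)
  also have "\<dots> = (real k + 1) * (2 * real j + real k + 2) * BM_c (Suc (j + k)) j"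
    using BM_c_add[of j "Suc k"] unfolding A[symmetric] B A'_def[symmetric] B_def[symmetric]
    by (simp add: mult_ac)
  finally show ?thesis .
qed

text \<open>This is the recurrence for \<open>BM_P\<close> read off coefficientwise in powers of
  \<open>x + 1\<close>; \<open>m\<close> is the index of the middle polynomial. At
  \<open>j = 0\<close> the truncated \<open>j - 1\<close> is harmless because of the factor
  \<open>j\<close>.\<close>

lemma BM_c_rec:
  fixes n :: nat
  defines "m \<equiv> real n + 1"
  shows "4 * (m + 1)\<^sup>2 * BM_c (n + 2) j =
    (16 * m\<^sup>2 + 16 * m + 6 - 4 * (2 * m + 1) + 4 * j - 8 * j * (2 * m + 1)) * BM_c (n + 1) j
    + 4 * (2 * m + 1) * j * BM_c (n + 1) (j - 1)
    + 8 * m * (j + 1) * BM_c (n + 1) (j + 1)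
    - (16 * m\<^sup>2 - 1) * BM_c n j"
proof -
  text \<open>For \<open>j \<le> n\<close> all terms are rational multiples of \<open>BM_c (n + 1) j\<close>. The remaining cases
    have vanishing terms, where the ratios break down.\<close>
  have "(\<exists>k. n = j + k) \<or> j = n + 1 \<or> j = n + 2 \<or> j > n + 2"
    unfolding le_iff_add[symmetric] by linarith
  then consider (le) k where "n = j + k" | (eq) "j = n + 1" | (eq2) "j = n + 2" | (gt) "j > n + 2"
    by blast
  then show ?thesis
  proof cases
    case le
    define X where "X = BM_c (n + 1) j"
    define p q where "p = real j" and "q = real k"
    have pq: "p \<ge> 0" "q \<ge> 0" and m: "m = p + q + 1"
      by (simp_all add: le m_def p_def q_def)
    have nz: "q + 1 \<noteq> 0" "q + 2 \<noteq> 0" "2 * q + 1 \<noteq> 0" "2 * p + q + 1 \<noteq> 0" "m \<noteq> 0" "m + 1 \<noteq> 0"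
      using pq m by auto
    have quot: "y = u / v * x" if "v * y = u * x" "v \<noteq> 0" for u v x y :: real
      using that by (simp add: field_simps)
    have "2 * (q + 1) * m * X = (2 * q + 1) * (2 * p + q + 1) * BM_c n j"
      using BM_c_Suc_left[of k j] by (simp add: le X_def m p_def q_def)
    then have a: "BM_c n j = 2 * (q + 1) * m / ((2 * q + 1) * (2 * p + q + 1)) * X"
      using nz by (intro quot) simp_all
    have "2 * (q + 2) * (m + 1) * BM_c (n + 2) j = (2 * q + 3) * (2 * p + q + 2) * X"
      using BM_c_Suc_left[of "Suc k" j] by (simp add: le X_def m p_def q_def add_ac)
    then have b: "BM_c (n + 2) j = (2 * q + 3) * (2 * p + q + 2) / (2 * (q + 2) * (m + 1)) * X"
      using nz by (intro quot) simp_all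
    have "(2 * q + 1) * ((p + 1) * BM_c (n + 1) (j + 1)) = (q + 1) * (2 * p + q + 2) * X"
      using BM_c_Suc_right[of k j] by (simp add: le X_def p_def q_def)
    then have c: "(p + 1) * BM_c (n + 1) (j + 1) = (q + 1) * (2 * p + q + 2) / (2 * q + 1) * X"
      using nz by (intro quot) simp_all
    \<comment> \<open>The factor \<open>p\<close> stays on the left so that \<open>j = 0\<close> is
      covered, where both sides vanish.\<close>
    have d: "p * BM_c (n + 1) (j - 1) = (2 * q + 3) * p\<^sup>2 / ((q + 2) * (2 * p + q + 1)) * X"
    proof (cases j)
      case (Suc i)
      have "(2 * q + 3) * p * X = (q + 2) * (2 * p + q + 1) * BM_c (n + 1) (j - 1)"
        using BM_c_Suc_right[of "Suc k" i] by (simp add: le X_def p_def q_def Suc algebra_simps)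
      then have "BM_c (n + 1) (j - 1) = (2 * q + 3) * p / ((q + 2) * (2 * p + q + 1)) * X"
        using nz by (intro quot) simp_all
      then show ?thesis by (simp add: power2_eq_square)
    qed (simp add: p_def)
    \<comment> \<open>With the common factor \<open>X\<close> removed, the recurrence is an identity
      of rational functions in \<open>p\<close> and \<open>q\<close>.\<close>
    have "4 * (m + 1)\<^sup>2 * ((2 * q + 3) * (2 * p + q + 2) / (2 * (q + 2) * (m + 1))) =
        (16 * m\<^sup>2 + 16 * m + 6 - 4 * (2 * m + 1) + 4 * p - 8 * p * (2 * m + 1))
        + 4 * (2 * m + 1) * ((2 * q + 3) * p\<^sup>2 / ((q + 2) * (2 * p + q + 1)))
        + 8 * m * ((q + 1) * (2 * p + q + 2) / (2 * q + 1))
        - (16 * m\<^sup>2 - 1) * (2 * (q + 1) * m / ((2 * q + 1) * (2 * p + q + 1)))" (is "?L = ?R")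
    proof -
      \<comment> \<open>One factor \<open>m + 1\<close> cancels, leaving only the denominators
        \<open>q + 2\<close>, \<open>2 * q + 1\<close> and \<open>2 * p + q + 1\<close>.\<close>
      have "?L = 2 * (m + 1) * ((2 * q + 3) * (2 * p + q + 2)) / (q + 2)"
        using nz by (simp add: divide_simps power2_eq_square) (simp add: algebra_simps)
      also have "\<dots> = ?R"
        using nz(1-4) unfolding m by (simp add: divide_simps) algebra
      finally show ?thesis .
    qed
    then have "4 * (m + 1)\<^sup>2 * BM_c (n + 2) j =
        (16 * m\<^sup>2 + 16 * m + 6 - 4 * (2 * m + 1) + 4 * p - 8 * p * (2 * m + 1)) * X
        + 4 * (2 * m + 1) * (p * BM_c (n + 1) (j - 1))
        + 8 * m * ((p + 1) * BM_c (n + 1) (j + 1))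
        - (16 * m\<^sup>2 - 1) * BM_c n j"
      unfolding a b c d by algebra
    then show ?thesis
      unfolding X_def p_def by (simp only: mult.assoc)
  next
    case eq
    have j: "real j = m" by (simp add: eq m_def)
    have z: "BM_c (n + 1) (j + 1) = 0" "BM_c n j = 0"
      by (simp_all add: BM_c_def eq)
    have "2 * (m + 1) * BM_c (n + 2) j = (2 * m + 1) * BM_c (n + 1) j"
      using BM_c_Suc_left[of 0 "n + 1"] by (simp add: eq m_def algebra_simps)
    moreover have "m * BM_c (n + 1) j = m * (2 * BM_c (n + 1) (j - 1))"
      using BM_c_Suc_right[of 0 n] by (simp add: eq m_def algebra_simps)
    ultimately show ?thesis
      unfolding z j by algebra
  next
    case eq2
    have j: "real j = m + 1" by (simp add: eq2 m_def)
    have z: "BM_c (n + 1) (j + 1) = 0" "BM_c n j = 0" "BM_c (n + 1) j = 0"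
      by (simp_all add: BM_c_def eq2)
    have "2 * (m + 1) * BM_c (n + 2) (j - 1) = (2 * m + 1) * BM_c (n + 1) (j - 1)"
      using BM_c_Suc_left[of 0 "n + 1"] by (simp add: eq2 m_def algebra_simps)
    moreover have "(m + 1) * BM_c (n + 2) j = (m + 1) * (2 * BM_c (n + 2) (j - 1))"
      using BM_c_Suc_right[of 0 "n + 1"] by (simp add: eq2 m_def algebra_simps)
    ultimately show ?thesis
      unfolding z j by algebra
  next
    case gt
    then show ?thesis by (simp add: BM_c_def)
  qed
qed

section \<open>Recurrences and coefficients of the polynomials\<close>

text \<open>\<open>BM_P n\<close> rewritten in the variable \<open>y = x + 1\<close>.\<close>

definition BM_S :: "nat \<Rightarrow> real poly" where
  "BM_S n = (\<Sum>j\<le>n. monom (BM_c n j) j)"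

lemma coeff_BM_S [simp]: "coeff (BM_S n) j = BM_c n j"
  by (auto simp: BM_S_def coeff_sum BM_c_def)

lemma BM_P_eq_sum: "BM_P n = (\<Sum>j\<le>n. smult (BM_c n j) ([:1, 1:] ^ j))"
proof -
  have "2 ^ (2 * n) = (4 ^ n :: real)"
    by (simp add: power_mult)
  then show ?thesis
    unfolding BM_P_def atMost_atLeast0
    by (intro poly_eqI) (simp add: coeff_sum sum_distrib_left BM_c_def)
qed

lemma BM_P_eq_pcompose: "BM_P n = pcompose (BM_S n) [:1, 1:]"
proof -
  have "pcompose (monom c j) q = smult c (q ^ j)" for c :: real and q j
    by (induction j) (simp_all add: monom_0 monom_Suc pcompose_pCons)
  then show ?thesis
    by (simp add: BM_P_eq_sum BM_S_def pcompose_sum)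
qed

text \<open>The multipliers are those of the recurrence for \<open>BM_P\<close> after substituting
  \<open>x = y - 1\<close>.\<close>

lemma BM_S_rec:
  fixes n :: nat
  defines "m \<equiv> real n + 1"
  shows "smult (4 * (m + 1)\<^sup>2) (BM_S (n + 2)) =
    [:16 * m\<^sup>2 + 16 * m + 6 - 4 * (2 * m + 1), 4 * (2 * m + 1):] * BM_S (n + 1)
    + [:8 * m, 4 - 8 * (2 * m + 1), 4 * (2 * m + 1):] * pderiv (BM_S (n + 1))
    - smult (16 * m\<^sup>2 - 1) (BM_S n)"
proof (rule poly_eqI)
  fix j
  show "coeff (smult (4 * (m + 1)\<^sup>2) (BM_S (n + 2))) j = coeff ([:16 * m\<^sup>2 + 16 * m + 6 - 4 * (2 * m + 1), 4 * (2 * m + 1):] * BM_S (n + 1)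
    + [:8 * m, 4 - 8 * (2 * m + 1), 4 * (2 * m + 1):] * pderiv (BM_S (n + 1))
    - smult (16 * m\<^sup>2 - 1) (BM_S n)) j"
    using BM_c_rec[of n j, folded m_def]
    \<comment> \<open>The indices 0 and 1 are split off because multiplication by a linear or
      quadratic polynomial shifts indices downwards.\<close>
    by (cases j; cases "j - 1") (auto simp: coeff_pderiv coeff_pCons algebra_simps)
qed

lemma BM_P_rec:
  fixes n :: nat
  defines "m \<equiv> real n + 1"
  shows "smult (4 * (m + 1)\<^sup>2) (BM_P (n + 2)) =
    [:16 * m\<^sup>2 + 16 * m + 6, 4 * (2 * m + 1):] * BM_P (n + 1)
    + [:0, 4, 4 * (2 * m + 1):] * pderiv (BM_P (n + 1))
    - smult (16 * m\<^sup>2 - 1) (BM_P n)"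
proof -
  have d: "pderiv (BM_P (n + 1)) = pcompose (pderiv (BM_S (n + 1))) [:1, 1:]"
    by (simp add: BM_P_eq_pcompose pderiv_pcompose pderiv_pCons)
  show ?thesis
  \<comment> \<open>Compared as functions, the shift of variable becomes evaluation at
    \<open>1 + x\<close>.\<close>
  proof (subst poly_eq_poly_eq_iff[symmetric], rule ext)
    fix x
    show "poly (smult (4 * (m + 1)\<^sup>2) (BM_P (n + 2))) x =
      poly ([:16 * m\<^sup>2 + 16 * m + 6, 4 * (2 * m + 1):] * BM_P (n + 1)
        + [:0, 4, 4 * (2 * m + 1):] * pderiv (BM_P (n + 1))
        - smult (16 * m\<^sup>2 - 1) (BM_P n)) x"
      using arg_cong[OF BM_S_rec[of n, folded m_def], of "\<lambda>p. poly p (1 + x)"]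
      unfolding d unfolding BM_P_eq_pcompose
      by (simp add: poly_pcompose algebra_simps power2_eq_square del: mult_pCons_left)
  qed
qed

lemma coeff_BM_P: "coeff (BM_P n) i = (\<Sum>j\<le>n. BM_c n j * real (j choose i))"
proof -
  have "coeff ([:1, 1:] ^ j) i = real (j choose i)" for j
    by (cases "i \<le> j") (simp_all add: coeff_linear_poly_power coeff_eq_0 degree_linear_power)
  then show ?thesis
    by (simp add: BM_P_eq_sum coeff_sum)
qed

text \<open>The summand \<open>j = n\<close> alone is positive, and no summand is negative.\<close>

lemma coeff_BM_P_pos:
  assumes "i \<le> n"
  shows "coeff (BM_P n) i > 0"
proof -
  have "0 < BM_c n n * real (n choose i)"
    using assms by (simp add: BM_c_pos)
  also have "\<dots> \<le> (\<Sum>j\<le>n. BM_c n j * real (j choose i))"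
    by (rule member_le_sum) (auto simp: BM_c_pos less_imp_le)
  finally show ?thesis
    by (simp add: coeff_BM_P)
qed

lemma coeff_BM_P_eq_0: "n < i \<Longrightarrow> coeff (BM_P n) i = 0"
  unfolding coeff_BM_P by (intro sum.neutral) simp

lemma coeff_BM_Q: "coeff (BM_Q n) i = coeff (BM_P n) i / fact i"
  by (auto simp: BM_Q_def BM_coeff_def coeff_sum coeff_BM_P_eq_0)

text \<open>In the recurrence for \<open>BM_P\<close>, the terms with \<open>4 * (2 * m + 1)\<close>
  contribute \<open>i * d (i - 1)\<close> to coefficient \<open>i\<close>, with \<open>d\<close> the
  coefficients of \<open>BM_P (n + 1)\<close>. Since \<open>i / fact i = 1 / fact (i - 1)\<close>
  for \<open>i > 0\<close>, dividing by \<open>fact i\<close> turns this into plain multiplication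
  by \<open>x\<close>, and the quadratic multiplier of the derivative disappears.\<close>

lemma BM_Q_rec:
  fixes n :: nat
  defines "m \<equiv> real n + 1"
  shows "smult (4 * (m + 1)\<^sup>2) (BM_Q (n + 2)) =
    [:16 * m\<^sup>2 + 16 * m + 6, 4 * (2 * m + 1):] * BM_Q (n + 1)
    + [:0, 4:] * pderiv (BM_Q (n + 1)) - smult (16 * m\<^sup>2 - 1) (BM_Q n)"
proof (rule poly_eqI)
  fix i
  let ?d = "\<lambda>n i. coeff (BM_P n) i"
  have "4 * (m + 1)\<^sup>2 * ?d (n + 2) i = (16 * m\<^sup>2 + 16 * m + 6 + 4 * i) * ?d (n + 1) i
    + 4 * (2 * m + 1) * i * ?d (n + 1) (i - 1) - (16 * m\<^sup>2 - 1) * ?d n i"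
    using arg_cong[OF BM_P_rec[of n, folded m_def], of "\<lambda>p. coeff p i"]
    by (cases i; cases "i - 1") (auto simp: coeff_pderiv coeff_pCons algebra_simps)
  then have "(4 * (m + 1)\<^sup>2 * ?d (n + 2) i) / fact i = ((16 * m\<^sup>2 + 16 * m + 6 + 4 * i) * ?d (n + 1) i
    + 4 * (2 * m + 1) * i * ?d (n + 1) (i - 1) - (16 * m\<^sup>2 - 1) * ?d n i) / fact i"
    by (rule arg_cong)
  then have *: "4 * (m + 1)\<^sup>2 * (?d (n + 2) i / fact i) = (16 * m\<^sup>2 + 16 * m + 6 + 4 * i) * (?d (n + 1) i / fact i)
    + 4 * (2 * m + 1) * (i * ?d (n + 1) (i - 1) / fact i) - (16 * m\<^sup>2 - 1) * (?d n i / fact i)"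
    by (simp only: add_divide_distrib diff_divide_distrib mult.assoc times_divide_eq_right)
  show "coeff (smult (4 * (m + 1)\<^sup>2) (BM_Q (n + 2))) i = coeff ([:16 * m\<^sup>2 + 16 * m + 6, 4 * (2 * m + 1):] * BM_Q (n + 1)
    + [:0, 4:] * pderiv (BM_Q (n + 1)) - smult (16 * m\<^sup>2 - 1) (BM_Q n)) i"
  proof (cases i)
    case 0
    then show ?thesis using * by (simp add: coeff_BM_Q algebra_simps)
  next
    case (Suc k)
    have "i * ?d (n + 1) (i - 1) / fact i = coeff (BM_Q (n + 1)) k"
      by (simp add: Suc coeff_BM_Q)
    then show ?thesis using *[folded coeff_BM_Q]
      by (simp add: Suc coeff_pderiv algebra_simps)
  qed
qed

section \<open>Real zeros and interlacing for \<open>BM_Q\<close>\<close>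

lemma degree_BM_Q [simp]: "degree (BM_Q n) = n"
  using coeff_BM_P_pos[of n n]
  by (intro antisym degree_le le_degree) (auto simp: coeff_BM_Q coeff_BM_P_eq_0)

lemma lead_coeff_BM_Q_pos: "coeff (BM_Q n) n > 0"
  by (simp add: coeff_BM_Q coeff_BM_P_pos)

lemma poly_BM_Q_pos:
  assumes "x \<ge> 0"
  shows "poly (BM_Q n) x > 0"
proof -
  have "poly (BM_Q n) x = (\<Sum>i\<le>n. coeff (BM_Q n) i * x ^ i)"
    by (simp add: poly_altdef)
  moreover have "coeff (BM_Q n) 0 * x ^ 0 \<le> (\<Sum>i\<le>n. coeff (BM_Q n) i * x ^ i)"
    using assms by (intro member_le_sum) (auto simp: coeff_BM_Q coeff_BM_P_pos less_imp_le)
  ultimately show ?thesis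
    using coeff_BM_P_pos[of 0 n] by (simp add: coeff_BM_Q)
qed

text \<open>The recurrence has order two, so the induction carries two consecutive polynomials
  together.\<close>

lemma BM_Q_zeros_interlaced:
  "\<exists>r s. simple_zeros (BM_Q n) n r \<and> simple_zeros (BM_Q (Suc n)) (Suc n) s \<and> zeros_interlaced n r s"
proof (induction n)
  case 0
  have "simple_zeros (BM_Q 0) 0 r" for r
    using lead_coeff_BM_Q_pos[of 0] by (simp add: simple_zeros_def)
  \<comment> \<open>For \<open>n = 0\<close> the alternation hypothesis is vacuous.\<close>
  then show ?case
    using zeros_interlaced_if_alternating[of "BM_Q 0" 0 _ "BM_Q 1"] lead_coeff_BM_Q_pos[of 1]
    by fastforce
next
  case (Suc n)
  then obtain r s where r: "simple_zeros (BM_Q n) n r"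
    and s: "simple_zeros (BM_Q (Suc n)) (Suc n) s" and rs: "zeros_interlaced n r s"
    by blast
  define m where "m = real n + 1"
  have "(-1) ^ i * poly (BM_Q (Suc (Suc n))) (s i) < 0" if i: "i < Suc n" for i
  proof -
    let ?x = "s i"
    have root: "poly (BM_Q (Suc n)) ?x = 0"
      using s i by (simp add: simple_zeros_def)
    then have neg: "?x < 0"
      using poly_BM_Q_pos[of ?x "Suc n"] by (metis less_irrefl not_le)
    have "4 * (m + 1)\<^sup>2 * poly (BM_Q (Suc (Suc n))) ?x
        = 4 * ?x * poly (pderiv (BM_Q (Suc n))) ?x - (16 * m\<^sup>2 - 1) * poly (BM_Q n) ?x"
      using arg_cong[OF BM_Q_rec[of n, folded m_def], of "\<lambda>p. poly p ?x"] root by simp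
    \<comment> \<open>The sign \<open>(-1) ^ i\<close> is generalised to an arbitrary
      \<open>e\<close>, which keeps the identity polynomial for \<open>algebra\<close>.\<close>
    then have "4 * (m + 1)\<^sup>2 * (e * poly (BM_Q (Suc (Suc n))) ?x)
        = 4 * (?x * (e * poly (pderiv (BM_Q (Suc n))) ?x))
          - (16 * m\<^sup>2 - 1) * (e * poly (BM_Q n) ?x)" for e
      by algebra
    from this[of "(-1) ^ i"] have "4 * (m + 1)\<^sup>2 * ((-1) ^ i * poly (BM_Q (Suc (Suc n))) ?x)
        = 4 * (?x * ((-1) ^ i * poly (pderiv (BM_Q (Suc n))) ?x))
          - (16 * m\<^sup>2 - 1) * ((-1) ^ i * poly (BM_Q n) ?x)" .
    moreover have "?x * ((-1) ^ i * poly (pderiv (BM_Q (Suc n))) ?x) < 0"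
      using neg simple_zeros_pderiv_sign[OF s i] by (rule mult_neg_pos)
    moreover have "(16 * m\<^sup>2 - 1) * ((-1) ^ i * poly (BM_Q n) ?x) > 0"
    proof (rule mult_pos_pos)
      have "m\<^sup>2 \<ge> 1" by (simp add: m_def)
      then show "16 * m\<^sup>2 - 1 > 0" by simp
      show "(-1) ^ i * poly (BM_Q n) ?x > 0"
        using simple_zeros_interlaced_sign[OF r s rs] i by simp
    qed
    ultimately have "4 * (m + 1)\<^sup>2 * ((-1) ^ i * poly (BM_Q (Suc (Suc n))) ?x) < 0"
      by linarith
    then show ?thesis
      by (simp add: mult_less_0_iff)
  qed
  then show ?case
    using zeros_interlaced_if_alternating[OF s, of "BM_Q (Suc (Suc n))"] s
      lead_coeff_BM_Q_pos[of "Suc (Suc n)"] by auto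
qed

theorem theorem2p3:
  shows "Sturm_sequence BM_Q \<and> (\<forall>n\<ge>1. BM_Q n \<in> RZ)"
proof -
  have "standard_poly (BM_Q n) \<and> BM_Q n \<noteq> 0 \<and> degree (BM_Q n) = n \<and> BM_Q n \<in> RZ
      \<and> BM_Q n \<prec> BM_Q (Suc n)" for n
  proof -
    obtain r s where rs: "simple_zeros (BM_Q n) n r" "simple_zeros (BM_Q (Suc n)) (Suc n) s"
        "zeros_interlaced n r s"
      using BM_Q_zeros_interlaced by blast
    then show ?thesis
      using simple_zeros_RZ[OF rs(1)] strictly_interlaces_if_zeros_interlaced[OF rs]
      by (auto simp: standard_poly_def simple_zeros_def)
  qed
  then show ?thesis
    by (simp add: Sturm_sequence_def)
qed

end
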